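(* Let $G$ be a graph of corner rank $\alpha$ and suppose the robber follows a Higher Way strategy. (1) If $G$ is $r$-cop-win ($r\in\{0,1\}$, so $\alpha\ge 2$ is finite), then the game lasts at least $\alpha-r$ cop moves. (2) If $\alpha=\infty$, then the cop never catches the robber.
   Context: All graphs are finite, nonempty and reflexive (every vertex adjacent to itself). For distinct vertices $v,w$ of a graph $H$: $w$ corners $v$ in $H$ if every vertex of $H$ adjacent to $v$ is adjacent to $w$; strictly corners if moreover some vertex of $H$ adjacent to $w$ is not adjacent to $v$; a strict corner of $H$ is a vertex strictly cornered in $H$ by another vertex. Corner ranking: $G_1=G$, $k=1$. If $G_k$ is a clique, its vertices get rank $k$; stop. Else if $G_k$ has no strict corners, its vertices get rank $\infty$; stop. Else the set $X$ of strict corners of $G_k$ gets rank $k$, $G_{k+1}=G_k-X$, increase $k$, repeat. $\mathrm{cr}(v)$ is the rank of $v$, $\mathrm{cr}(G)$ the maximum rank ($\infty$ largest). If $\mathrm{cr}(G)=\infty$, let $G_\infty$ be the final graph of the procedure (the vertices of rank $\infty$). For finite corner rank $\alpha\ge2$ (standing convention: finite-rank graphs have rank $\ge2$): $G$ is $1$-cop-win if some (equivalently every) vertex of rank $\alpha$ is adjacent to all vertices of $G_{\alpha-1}$, otherwise $0$-cop-win. Projections: for $k$ with $G_{k+1}$ defined, $f_k(\{u\})=\{u\}$ if $\mathrm{cr}(u)>k$, otherwise the set of vertices of $G_{k+1}$ that strictly corner $u$ in $G_k$; $f_k(S)=\bigcup_{u\in S}f_k(\{u\})$. $F_1$ is the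 identity, $F_k=f_{k-1}\circ\cdots\circ f_1$. If $\mathrm{cr}(G)=\infty$ and $\gamma$ is the largest finite rank present, $F_\infty=f_\gamma\circ\cdots\circ f_1$; if there is no vertex of finite rank, $F_\infty$ is the identity. $F_k(v)=F_k(\{v\})$. Game: cop places, robber places, then alternate moves with the cop first; a move is staying or moving to an adjacent vertex; the cop wins when both share a vertex. With the cop at $c$, a vertex $x$ is $k$-proj-safe if $\mathrm{cr}(x)\ge k$ and some $c'\in F_k(c)$ is not adjacent to $x$. A Higher Way robber strategy: at every turn (including the initial placement) the robber goes to a $k$-proj-safe vertex with $k$ maximum; if there is none, he moves arbitrarily to a vertex not occupied by the cop. *)

theory Defs
  imports Main "HOL-Library.Extended_Nat"
begin

locale reflexive_graph =
  fixes V :: "'a set" and E :: "('a \<times> 'a) set"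
  assumes finite_vertices: "finite V"
    and nonempty: "V \<noteq> {}"
    and edges: "E \<subseteq> V \<times> V"
    and reflexive: "refl_on V E"
    and symmetric: "sym E"

text \<open>In the next four definitions \<open>W\<close> is a vertex set and stands for the subgraph that it induces.\<close>

definition corners :: "('a \<times> 'a) set \<Rightarrow> 'a set \<Rightarrow> 'a \<Rightarrow> 'a \<Rightarrow> bool" where
  "corners E W w v \<longleftrightarrow> w \<in> W \<and> v \<in> W \<and> w \<noteq> v \<and> (\<forall>u\<in>W. (u, v) \<in> E \<longrightarrow> (u, w) \<in> E)"

definition strictly_corners :: "('a \<times> 'a) set \<Rightarrow> 'a set \<Rightarrow> 'a \<Rightarrow> 'a \<Rightarrow> bool" where
  "strictly_corners E W w v \<longleftrightarrow> corners E W w v \<and> (\<exists>u\<in>W. (u, w) \<in> E \<and> (u, v) \<notin> E)"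

definition strict_corners :: "('a \<times> 'a) set \<Rightarrow> 'a set \<Rightarrow> 'a set" where
  "strict_corners E W = {v \<in> W. \<exists>w\<in>W. strictly_corners E W w v}"

definition is_clique :: "('a \<times> 'a) set \<Rightarrow> 'a set \<Rightarrow> bool" where
  "is_clique E W \<longleftrightarrow> (\<forall>u\<in>W. \<forall>v\<in>W. (u, v) \<in> E)"

text \<open>The vertex set of \<open>G\<^sub>k\<close>, for \<open>k \<ge> 1\<close>. A clique has no strict corners, so this sequence is
  constant from the index \<open>last_stage\<close> on at which the ranking procedure stops; \<open>G\<^sub>k\<close> itself is
  defined only for \<open>1 \<le> k \<le> last_stage\<close>.\<close>

definition stage :: "'a set \<Rightarrow> ('a \<times> 'a) set \<Rightarrow> nat \<Rightarrow> 'a set" where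
  "stage V E k = ((\<lambda>W. W - strict_corners E W) ^^ (k - 1)) V"

definition last_stage :: "'a set \<Rightarrow> ('a \<times> 'a) set \<Rightarrow> nat" where
  "last_stage V E =
     (LEAST k. 1 \<le> k \<and> (is_clique E (stage V E k) \<or> strict_corners E (stage V E k) = {}))"

definition cr :: "'a set \<Rightarrow> ('a \<times> 'a) set \<Rightarrow> 'a \<Rightarrow> enat" where
  "cr V E v =
     (if v \<in> stage V E (last_stage V E)
      then (if is_clique E (stage V E (last_stage V E)) then enat (last_stage V E) else \<infinity>)
      else enat (THE k. 1 \<le> k \<and> k < last_stage V E \<and> v \<in> strict_corners E (stage V E k)))"

definition graph_cr :: "'a set \<Rightarrow> ('a \<times> 'a) set \<Rightarrow> enat" where
  "graph_cr V E = Max (cr V E ` V)"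

definition cop_win :: "'a set \<Rightarrow> ('a \<times> 'a) set \<Rightarrow> nat \<Rightarrow> bool" where
  "cop_win V E r \<longleftrightarrow>
     (\<exists>\<alpha>. graph_cr V E = enat \<alpha> \<and> 2 \<le> \<alpha> \<and>
        r = (if \<exists>v\<in>V. cr V E v = enat \<alpha> \<and> (\<forall>w\<in>stage V E (\<alpha> - 1). (v, w) \<in> E) then 1 else 0))"

text \<open>The map \<open>f\<^sub>k\<close>, meaningful for \<open>1 \<le> k < last_stage\<close> and subsets of \<open>G\<^sub>k\<close>.\<close>

definition project :: "'a set \<Rightarrow> ('a \<times> 'a) set \<Rightarrow> nat \<Rightarrow> 'a set \<Rightarrow> 'a set" where
  "project V E k S =
     (\<Union>u\<in>S. if cr V E u > enat k then {u}
             else {w \<in> stage V E (Suc k). strictly_corners E (stage V E k) w u})"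

text \<open>\<open>project_upto V E n\<close> is \<open>f\<^sub>n \<circ> \<dots> \<circ> f\<^sub>1\<close>, so \<open>F\<^sub>k\<close> takes \<open>n = k - 1\<close>.\<close>

primrec project_upto :: "'a set \<Rightarrow> ('a \<times> 'a) set \<Rightarrow> nat \<Rightarrow> 'a set \<Rightarrow> 'a set" where
  "project_upto V E 0 S = S"
| "project_upto V E (Suc n) S = project V E (Suc n) (project_upto V E n S)"

definition max_finite_rank :: "'a set \<Rightarrow> ('a \<times> 'a) set \<Rightarrow> nat" where
  "max_finite_rank V E =
     (if \<exists>v\<in>V. cr V E v \<noteq> \<infinity> then Max {k. \<exists>v\<in>V. cr V E v = enat k} else 0)"

definition F :: "'a set \<Rightarrow> ('a \<times> 'a) set \<Rightarrow> enat \<Rightarrow> 'a set \<Rightarrow> 'a set" where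
  "F V E k S =
     (case k of enat n \<Rightarrow> project_upto V E (n - 1) S
              | \<infinity> \<Rightarrow> project_upto V E (max_finite_rank V E) S)"

text \<open>\<open>F\<^sub>k\<close> makes sense for finite \<open>k\<close> such that \<open>G\<^sub>k\<close> is defined, and for \<open>k = \<infinity>\<close> if the corner rank
  of the graph is infinite (which \<open>k \<le> cr V E x\<close> forces below).\<close>

definition proj_safe :: "'a set \<Rightarrow> ('a \<times> 'a) set \<Rightarrow> 'a \<Rightarrow> enat \<Rightarrow> 'a \<Rightarrow> bool" where
  "proj_safe V E c k x \<longleftrightarrow>
     k \<in> enat ` {1..last_stage V E} \<union> {\<infinity>} \<and> x \<in> V \<and> k \<le> cr V E x \<and>
     (\<exists>c'\<in>F V E k {c}. (c', x) \<notin> E)"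

text \<open>The cop is at \<open>c\<close>, and the robber, who may move to any vertex of \<open>A\<close>, moves to \<open>x\<close>.\<close>

definition higher_way_move :: "'a set \<Rightarrow> ('a \<times> 'a) set \<Rightarrow> 'a \<Rightarrow> 'a set \<Rightarrow> 'a \<Rightarrow> bool" where
  "higher_way_move V E c A x \<longleftrightarrow> x \<in> A \<and>
     (if \<exists>y\<in>A. \<exists>j. proj_safe V E c j y
      then \<exists>k. proj_safe V E c k x \<and> (\<forall>y\<in>A. \<forall>j. proj_safe V E c j y \<longrightarrow> j \<le> k)
      else x \<noteq> c)"

text \<open>A play is described by the positions \<open>c n\<close> and \<open>r n\<close> of cop and robber after \<open>n\<close> moves each;
  \<open>c 0\<close> and \<open>r 0\<close> are the initial placements, and \<open>c (Suc n)\<close> is chosen when the robber is at \<open>r n\<close>.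
  Sequences are infinite; what happens after the capture is irrelevant.\<close>

definition cop_moves :: "'a set \<Rightarrow> ('a \<times> 'a) set \<Rightarrow> (nat \<Rightarrow> 'a) \<Rightarrow> bool" where
  "cop_moves V E c \<longleftrightarrow> c 0 \<in> V \<and> (\<forall>n. (c n, c (Suc n)) \<in> E)"

text \<open>The players share a vertex after the \<open>n\<close>-th cop move (if \<open>n \<ge> 1\<close>), or after the robber's reply
  to it (his placement if \<open>n = 0\<close>).\<close>

definition caught :: "(nat \<Rightarrow> 'a) \<Rightarrow> (nat \<Rightarrow> 'a) \<Rightarrow> nat \<Rightarrow> bool" where
  "caught c r n \<longleftrightarrow> c n = r n \<or> (1 \<le> n \<and> c n = r (n - 1))"

text \<open>The number of cop moves, placement not counted, until the robber is first caught; it is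
  \<open>\<infinity>\<close>, the infimum of the empty set, if this never happens.\<close>

definition game_length :: "(nat \<Rightarrow> 'a) \<Rightarrow> (nat \<Rightarrow> 'a) \<Rightarrow> enat" where
  "game_length c r = (INF n\<in>{n. caught c r n}. enat n)"

text \<open>A robber strategy maps the list of all cop positions so far, oldest first, to the robber's next
  position; his own earlier positions are determined by it.\<close>

definition robber_path :: "('a list \<Rightarrow> 'a) \<Rightarrow> (nat \<Rightarrow> 'a) \<Rightarrow> nat \<Rightarrow> 'a" where
  "robber_path \<sigma> c n = \<sigma> (map c [0..<Suc n])"

text \<open>The premise on \<open>i\<close> says that the game is still on at the robber's \<open>n\<close>-th turn.\<close>

definition higher_way_strategy :: "'a set \<Rightarrow> ('a \<times> 'a) set \<Rightarrow> ('a list \<Rightarrow> 'a) \<Rightarrow> bool" where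
  "higher_way_strategy V E \<sigma> \<longleftrightarrow>
     (\<forall>c n. cop_moves V E c \<longrightarrow>
        (\<forall>i<n. c i \<noteq> robber_path \<sigma> c i \<and> c (Suc i) \<noteq> robber_path \<sigma> c i) \<longrightarrow>
        higher_way_move V E (c n)
          (if n = 0 then V else {y. (robber_path \<sigma> c (n - 1), y) \<in> E})
          (robber_path \<sigma> c n))"

end

theory Submission
  imports Defs
begin

text \<open>If the cop moves from \<open>c\<close> to \<open>d\<close> and \<open>x\<close> is a vertex of \<open>G\<^sub>k\<^sub>+\<^sub>1\<close> not adjacent to some
  \<open>c' \<in> F\<^sub>k\<^sub>+\<^sub>1(c)\<close>, then every \<open>d' \<in> F\<^sub>k(d)\<close> is adjacent to \<open>c'\<close>. As \<open>x\<close> is not a strict corner of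
  \<open>G\<^sub>k\<close>, \<open>d'\<close> cannot be adjacent to all neighbours of \<open>x\<close> in \<open>G\<^sub>k\<close>. So the robber loses at most one
  level of projected safety per move, and none on \<open>G\<^sub>\<infinity>\<close>, which has no strict corners. A projected safe
  vertex is not adjacent to the cop because the projections preserve adjacency and fix the
  vertices of high rank. It remains to bound the level available at the placement: if a vertex
  dominates \<open>G\<^sub>k\<close>, then all vertices that do not dominate are strict corners, so \<open>G\<^sub>k\<^sub>+\<^sub>1\<close> is a clique.\<close>

section \<open>Strict cornering as proper inclusion of neighbourhoods\<close>

lemma strictly_corners_iff:
  "strictly_corners E W w v \<longleftrightarrow>
     w \<in> W \<and> v \<in> W \<and> {u\<in>W. (u, v) \<in> E} \<subset> {u\<in>W. (u, w) \<in> E}"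
  unfolding strictly_corners_def corners_def by blast

text \<open>Among the neighbourhoods of the vertices strictly cornering \<open>v\<close> choose a
  maximal one. By transitivity, anything strictly cornering its owner would strictly corner
  \<open>v\<close> with a larger neighbourhood. This is why stages stay nonempty and projections
  never vanish.\<close>

lemma strict_corner_by_nonstrict:
  assumes "finite W" "v \<in> strict_corners E W"
  obtains w where "w \<in> W - strict_corners E W" "strictly_corners E W w v"
proof -
  let ?N = "\<lambda>w. {u\<in>W. (u, w) \<in> E}"
  let ?A = "?N ` {w. strictly_corners E W w v}"
  have "{w. strictly_corners E W w v} \<subseteq> W"
    by (auto simp: strictly_corners_iff)
  then have "finite ?A" using assms(1) finite_subset by blast
  moreover have "?A \<noteq> {}" using assms(2) by (auto simp: strict_corners_def)
  ultimately obtain m where m: "m \<in> ?A" "\<forall>b\<in>?A. m \<subseteq> b \<longrightarrow> m = b"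
    by (meson finite_has_maximal)
  then obtain w where w: "strictly_corners E W w v" "m = ?N w" by blast
  have "w \<notin> strict_corners E W"
  proof
    assume "w \<in> strict_corners E W"
    then obtain z where z: "strictly_corners E W z w" by (auto simp: strict_corners_def)
    then have "?N w \<subset> ?N z" by (auto simp: strictly_corners_iff)
    moreover from this w have "strictly_corners E W z v"
      using z unfolding strictly_corners_iff by blast
    ultimately show False using m(2) w(2) by blast
  qed
  with w that show thesis by (auto simp: strictly_corners_iff)
qed

lemma strict_corners_subset: "strict_corners E W \<subseteq> W"
  by (auto simp: strict_corners_def)

text \<open>If \<open>d\<close> were adjacent to every neighbour of \<open>x\<close> in
  \<open>W\<close>, then \<open>c\<close>, a neighbour of \<open>d\<close> but not of
  \<open>x\<close>, would make the inclusion proper and \<open>x\<close> a strict corner. In use,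
  \<open>c\<close> and \<open>d\<close> are projected cop positions before and after a move.\<close>

lemma escape_within:
  assumes "sym E" "x \<in> W" "x \<notin> strict_corners E W" "d \<in> W" "c \<in> W"
    and "(c, d) \<in> E" "(c, x) \<notin> E"
  obtains y where "y \<in> W" "(x, y) \<in> E" "(d, y) \<notin> E"
proof -
  have "\<not> strictly_corners E W d x" using assms by (auto simp: strict_corners_def)
  then obtain y where "y \<in> W" "(y, x) \<in> E" "(y, d) \<notin> E"
    using assms unfolding strictly_corners_iff by blast
  then show thesis using that \<open>sym E\<close> by (meson symD)
qed

lemma dominating_imp_clique:
  assumes "sym E" "d \<in> W" "\<forall>w\<in>W. (d, w) \<in> E"
  shows "is_clique E (W - strict_corners E W)"
  unfolding is_clique_def
proof (intro ballI)
  fix u v assume uv: "u \<in> W - strict_corners E W" "v \<in> W - strict_corners E W"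
  then have "\<not> strictly_corners E W d v" using assms by (auto simp: strict_corners_def)
  moreover have "\<forall>w\<in>W. (w, d) \<in> E" using assms by (meson symD)
  ultimately show "(u, v) \<in> E" using uv \<open>d \<in> W\<close> unfolding strictly_corners_iff by blast
qed

section \<open>Stages of the ranking procedure\<close>

context reflexive_graph
begin

abbreviation "G \<equiv> stage V E"
abbreviation "L \<equiv> last_stage V E"

lemma stage_1 [simp]: "G (Suc 0) = V"
  by (simp add: stage_def)

lemma stage_Suc: "1 \<le> k \<Longrightarrow> G (Suc k) = G k - strict_corners E (G k)"
  by (cases k) (auto simp: stage_def)

lemma stage_Suc_subset: "G (Suc k) \<subseteq> G k"
  \<comment> \<open>Because \<open>k - 1\<close> truncates, \<open>G 0\<close> and
    \<open>G 1\<close> are both \<open>V\<close>.\<close>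
  by (cases "k = 0") (auto simp: stage_Suc, simp add: stage_def)

lemma stage_antimono: "j \<le> k \<Longrightarrow> G k \<subseteq> G j"
  by (rule lift_Suc_antimono_le[of G]) (use stage_Suc_subset in auto)

lemma stage_subset: "G k \<subseteq> V"
  using stage_antimono[of 0 k] by (simp add: stage_def)

lemma finite_stage: "finite (G k)"
  using stage_subset finite_vertices finite_subset by blast

lemma stage_nonempty: "G k \<noteq> {}"
proof (induction k)
  case 0
  then show ?case using nonempty by (simp add: stage_def)
next
  case (Suc k)
  show ?case
  proof (cases "k = 0")
    case True
    then show ?thesis using nonempty by simp
  next
    case False
    show ?thesis
    proof
      assume "G (Suc k) = {}"
      with False Suc obtain v where "v \<in> strict_corners E (G k)"
        by (auto simp: stage_Suc)
      then obtain w where "w \<in> G k - strict_corners E (G k)"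
        using strict_corner_by_nonstrict[OF finite_stage] by metis
      with \<open>G (Suc k) = {}\<close> False show False by (auto simp: stage_Suc)
    qed
  qed
qed

text \<open>Otherwise each stage loses a vertex, so \<open>k\<close> removals need
  \<open>card V\<close> to be at least \<open>k\<close>.\<close>

lemma ex_stage_without_strict_corners: "\<exists>k\<ge>1. strict_corners E (G k) = {}"
proof (rule ccontr)
  assume "\<not> ?thesis"
  then have ne: "strict_corners E (G k) \<noteq> {}" if "k \<ge> 1" for k using that by blast
  have "card (G (Suc k)) + k \<le> card V" for k
  proof (induction k)
    case (Suc k)
    have "G (Suc (Suc k)) \<subset> G (Suc k)"
      using ne[of "Suc k"] strict_corners_subset[of E "G (Suc k)"] by (auto simp: stage_Suc)
    then have "card (G (Suc (Suc k))) < card (G (Suc k))"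
      by (simp add: finite_stage psubset_card_mono)
    with Suc show ?case by simp
  qed simp
  from this[of "Suc (card V)"] show False by simp
qed

lemma last_stage:
  shows last_stage_ge_1: "1 \<le> L"
    and last_stage_stops: "is_clique E (G L) \<or> strict_corners E (G L) = {}"
proof -
  have "\<exists>k. 1 \<le> k \<and> (is_clique E (G k) \<or> strict_corners E (G k) = {})"
    using ex_stage_without_strict_corners by blast
  from LeastI_ex[OF this] show "1 \<le> L" "is_clique E (G L) \<or> strict_corners E (G L) = {}"
    unfolding last_stage_def by blast+
qed

lemma before_last_stage:
  assumes "1 \<le> k" "k < L"
  shows "\<not> is_clique E (G k)" "strict_corners E (G k) \<noteq> {}"
  using not_less_Least[OF assms(2)[unfolded last_stage_def]] assms(1) by auto

section \<open>Ranks in terms of stages\<close>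

lemma cr_strict_corner:
  assumes "1 \<le> k" "k < L" "v \<in> strict_corners E (G k)"
  shows "cr V E v = enat k"
proof -
  \<comment> \<open>A removed vertex never returns, so the index described by \<open>THE\<close> is
    unique and \<open>v\<close> is missing from \<open>G L\<close>.\<close>
  have out: "v \<notin> G n" if "j < n" "1 \<le> j" "v \<in> strict_corners E (G j)" for j n
    using that stage_antimono[of "Suc j" n] by (auto simp: stage_Suc)
  have "j = k" if "1 \<le> j" "v \<in> strict_corners E (G j)" for j
    using that assms out[of j k] out[of k j] strict_corners_subset[of E]
    by (meson linorder_neqE_nat subsetD)
  then have "(THE j. 1 \<le> j \<and> j < L \<and> v \<in> strict_corners E (G j)) = k"
    using assms by (intro the_equality) blast+
  then show ?thesis using assms out[of k L] by (simp add: cr_def)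
qed

lemma strict_corner_if_not_last:
  assumes "v \<in> V" "v \<notin> G n" "1 \<le> n"
  obtains k where "1 \<le> k" "k < n" "v \<in> strict_corners E (G k)"
  using assms(3,2)
proof (induction n arbitrary: thesis rule: dec_induct)
  case base
  then show ?case using assms(1) by simp
next
  case (step n)
  then show ?case by (cases "v \<in> G n") (auto simp: stage_Suc less_Suc_eq)
qed

text \<open>The bridge that lets later arguments replace ranks by stage membership: a vertex removed
  from \<open>G j\<close> lies in exactly the stages up to \<open>j\<close>.\<close>

lemma enat_le_cr_iff:
  assumes "v \<in> V" "1 \<le> k" "k \<le> L"
  shows "enat k \<le> cr V E v \<longleftrightarrow> v \<in> G k"
proof (cases "v \<in> G L")
  case True
  then show ?thesis using assms stage_antimono[of k L] by (auto simp: cr_def)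
next
  case False
  then obtain j where j: "1 \<le> j" "j < L" "v \<in> strict_corners E (G j)"
    using strict_corner_if_not_last assms(1) last_stage_ge_1 by blast
  have "v \<in> G j" using j strict_corners_subset[of E] by blast
  moreover have "v \<notin> G (Suc j)" using j by (simp add: stage_Suc)
  ultimately have "v \<in> G k \<longleftrightarrow> k \<le> j"
    using stage_antimono[of k j] stage_antimono[of "Suc j" k] not_less_eq_eq by blast
  then show ?thesis using cr_strict_corner[OF j] by simp
qed

lemma enat_less_cr_iff:
  assumes "v \<in> V" "k < L"
  shows "enat k < cr V E v \<longleftrightarrow> v \<in> G (Suc k)"
  using enat_le_cr_iff[of v "Suc k"] assms by (simp add: Suc_ile_eq)

lemma graph_cr_eq: "graph_cr V E = (if is_clique E (G L) then enat L else \<infinity>)"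
  unfolding graph_cr_def
proof (rule Max_eqI)
  let ?m = "if is_clique E (G L) then enat L else \<infinity>"
  show "finite (cr V E ` V)" using finite_vertices by simp
  obtain v where "v \<in> G L" using stage_nonempty by blast
  then have "v \<in> V" "cr V E v = ?m" using stage_subset by (auto simp: cr_def)
  then show "?m \<in> cr V E ` V" by force
  fix y assume "y \<in> cr V E ` V"
  then obtain u where u: "u \<in> V" "y = cr V E u" by blast
  show "y \<le> ?m"
  proof (cases "u \<in> G L")
    case True
    then show ?thesis using u by (simp add: cr_def)
  next
    case False
    then obtain j where "j < L" "cr V E u = enat j"
      using u strict_corner_if_not_last last_stage_ge_1 cr_strict_corner by metis
    then show ?thesis using u by simp
  qed
qed

text \<open>Every stage before \<open>L\<close> loses a vertex, so the finite ranks are exactly 1 to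
  \<open>L - 1\<close>. Hence \<open>F\<close> at \<infinity> and at \<open>L\<close> are the same
  map.\<close>

lemma max_finite_rank_eq:
  assumes "\<not> is_clique E (G L)"
  shows "max_finite_rank V E = L - 1"
proof -
  have "{k. \<exists>v\<in>V. cr V E v = enat k} = {1..<L}"
  proof (intro set_eqI iffI)
    fix k assume "k \<in> {k. \<exists>v\<in>V. cr V E v = enat k}"
    then obtain v where v: "v \<in> V" "cr V E v = enat k" by blast
    then have "v \<notin> G L" using assms by (auto simp: cr_def)
    then show "k \<in> {1..<L}"
      using v strict_corner_if_not_last[of v L] last_stage_ge_1 cr_strict_corner
      by (metis atLeastLessThan_iff enat.inject)
  next
    fix k assume "k \<in> {1..<L}"
    then obtain v where "v \<in> strict_corners E (G k)" "cr V E v = enat k"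
      using before_last_stage cr_strict_corner by (metis atLeastLessThan_iff ex_in_conv)
    then show "k \<in> {k. \<exists>v\<in>V. cr V E v = enat k}"
      using strict_corners_subset[of E] stage_subset by blast
  qed
  moreover have "(\<exists>v\<in>V. cr V E v \<noteq> \<infinity>) \<longleftrightarrow> {k. \<exists>v\<in>V. cr V E v = enat k} \<noteq> {}"
    by auto
  moreover have "Max {1..<L} = L - 1" if "1 < L"
    using that by (intro Max_eqI) auto
  \<comment> \<open>For \<open>L = 1\<close> no rank is finite, and the default value 0 is again
    \<open>L - 1\<close>.\<close>
  ultimately show ?thesis unfolding max_finite_rank_def using last_stage_ge_1 by auto
qed

section \<open>Projections\<close>

lemma in_project:
  assumes "1 \<le> k" "k < L" "S \<subseteq> G k"
  shows "w \<in> project V E k S \<longleftrightarrow> w \<in> G (Suc k) \<and>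
    (\<exists>u\<in>S. if u \<in> G (Suc k) then w = u else strictly_corners E (G k) w u)"
proof -
  have "enat k < cr V E u \<longleftrightarrow> u \<in> G (Suc k)" if "u \<in> S" for u
    using that assms stage_subset enat_less_cr_iff by blast
  then show ?thesis by (auto simp: project_def split: if_splits)
qed

text \<open>Whether \<open>u\<close> is kept or replaced by a vertex cornering it, no neighbour
  within \<open>G k\<close> is lost. Adjacency arguments about projections rest on this.\<close>

lemma project_adjacent:
  assumes "1 \<le> k" "k < L" "S \<subseteq> G k" "w \<in> project V E k S"
  obtains u where "u \<in> S" "\<And>v. v \<in> G k \<Longrightarrow> (v, u) \<in> E \<Longrightarrow> (v, w) \<in> E"
  using assms by (auto simp: in_project strictly_corners_def corners_def split: if_splits)

lemma project_nonempty:
  assumes "1 \<le> k" "k < L" "S \<subseteq> G k" "S \<noteq> {}"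
  shows "project V E k S \<noteq> {}"
proof -
  obtain u where u: "u \<in> S" "u \<in> G k" using assms by blast
  have "\<exists>w. w \<in> project V E k S"
  proof (cases "u \<in> G (Suc k)")
    case True
    with u assms show ?thesis by (auto simp: in_project)
  next
    case False
    with u assms have "u \<in> strict_corners E (G k)" by (simp add: stage_Suc)
    then obtain w where "w \<in> G k - strict_corners E (G k)" "strictly_corners E (G k) w u"
      using strict_corner_by_nonstrict[OF finite_stage] by metis
    with u False assms show ?thesis by (auto simp: in_project stage_Suc)
  qed
  then show ?thesis by blast
qed

lemma project_upto_stage:
  assumes "k < L" "S \<subseteq> V"
  shows "project_upto V E k S \<subseteq> G (Suc k)"
  using assms by (induction k) (auto simp: in_project)

lemma project_upto_nonempty:
  assumes "k < L" "S \<subseteq> V" "S \<noteq> {}"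
  shows "project_upto V E k S \<noteq> {}"
  using assms by (induction k) (auto simp: project_nonempty project_upto_stage)

lemma project_upto_fixed:
  assumes "k < L" "x \<in> G (Suc k)"
  shows "project_upto V E k {x} = {x}"
  using assms
proof (induction k)
  case (Suc k)
  then have x: "x \<in> G (Suc k)" using stage_Suc_subset by blast
  with Suc have "project_upto V E k {x} = {x}" by simp
  moreover have "project V E (Suc k) {x} = {x}"
    using in_project[of "Suc k" "{x}"] x Suc.prems by auto
  ultimately show ?case by simp
qed simp

lemma vertex_of_edge: "(u, v) \<in> E \<Longrightarrow> u \<in> V" "(u, v) \<in> E \<Longrightarrow> v \<in> V"
  using edges by auto

lemma edge_sym: "(u, v) \<in> E \<Longrightarrow> (v, u) \<in> E"
  using symmetric by (meson symD)

text \<open>In each projection step the ends of an edge are replaced one after the other: first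
  \<open>u\<close> by \<open>c'\<close>, then \<open>w\<close> by \<open>d'\<close>.\<close>

lemma project_upto_adjacent:
  assumes "k < L" "(c, d) \<in> E" "c' \<in> project_upto V E k {c}" "d' \<in> project_upto V E k {d}"
  shows "(c', d') \<in> E"
  using assms
proof (induction k arbitrary: c' d')
  case (Suc k)
  have k: "1 \<le> Suc k" "Suc k < L" using Suc.prems by auto
  have sub: "project_upto V E k {c} \<subseteq> G (Suc k)" "project_upto V E k {d} \<subseteq> G (Suc k)"
    using project_upto_stage[of k] Suc.prems vertex_of_edge by simp_all
  obtain u where u: "u \<in> project_upto V E k {c}"
      "\<And>v. v \<in> G (Suc k) \<Longrightarrow> (v, u) \<in> E \<Longrightarrow> (v, c') \<in> E"
    using project_adjacent[OF k sub(1)] Suc.prems by auto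
  obtain w where w: "w \<in> project_upto V E k {d}"
      "\<And>v. v \<in> G (Suc k) \<Longrightarrow> (v, w) \<in> E \<Longrightarrow> (v, d') \<in> E"
    using project_adjacent[OF k sub(2)] Suc.prems by auto
  have "(u, w) \<in> E" using Suc u w by simp
  then have "(w, c') \<in> E" using u w sub edge_sym by blast
  \<comment> \<open>Only neighbours inside \<open>G (Suc k)\<close> are known to be inherited by
    \<open>d'\<close>, so \<open>c'\<close> must lie there.\<close>
  moreover have "c' \<in> G (Suc k)"
    using Suc.prems k sub(1) stage_Suc_subset[of "Suc k"] by (auto simp: in_project)
  ultimately show ?case using w edge_sym by blast
qed simp

section \<open>Projected safety\<close>

text \<open>Level \<open>n\<close> is \<open>n\<close>-proj-safety; in a graph of infinite corner rank \<open>L\<close> also encodes \<open>\<infinity>\<close>.\<close>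

definition safe_at :: "nat \<Rightarrow> 'a \<Rightarrow> 'a \<Rightarrow> bool" where
  "safe_at n c x \<longleftrightarrow> 1 \<le> n \<and> n \<le> L \<and> x \<in> G n \<and>
     (\<exists>c'\<in>project_upto V E (n - 1) {c}. (c', x) \<notin> E)"

lemma proj_safe_imp_safe_at:
  assumes "proj_safe V E c k x"
  shows "safe_at (case k of enat n \<Rightarrow> n | \<infinity> \<Rightarrow> L) c x"
proof (cases k)
  case (enat n)
  with assms show ?thesis
    by (auto simp: proj_safe_def safe_at_def F_def enat_le_cr_iff)
next
  case infinity
  with assms have cr: "x \<in> V" "cr V E x = \<infinity>" by (auto simp: proj_safe_def)
  then have x: "x \<in> G L"
    using enat_le_cr_iff[of x L] last_stage_ge_1 by simp
  with cr have "\<not> is_clique E (G L)" by (auto simp: cr_def split: if_splits)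
  with assms infinity x show ?thesis
    using last_stage_ge_1 by (auto simp: proj_safe_def safe_at_def F_def max_finite_rank_eq)
qed

lemma safe_at_imp_proj_safe:
  assumes "safe_at n c x"
  shows "proj_safe V E c (enat n) x"
proof -
  have "x \<in> V" using assms stage_subset by (auto simp: safe_at_def)
  then show ?thesis using assms by (auto simp: proj_safe_def safe_at_def F_def enat_le_cr_iff)
qed

lemma safe_at_imp_proj_safe_infinity:
  assumes "safe_at L c x" "\<not> is_clique E (G L)"
  shows "proj_safe V E c \<infinity> x"
  using assms stage_subset by (auto simp: proj_safe_def safe_at_def F_def max_finite_rank_eq cr_def)

lemma safe_at_not_adjacent:
  assumes "safe_at n c x"
  shows "(c, x) \<notin> E"
  using assms project_upto_adjacent[of "n - 1" c x] project_upto_fixed[of "n - 1" x]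
  by (auto simp: safe_at_def)

lemma safe_at_neq:
  assumes "safe_at n c x"
  shows "c \<noteq> x"
proof
  assume "c = x"
  moreover have "x \<in> V" using assms stage_subset by (auto simp: safe_at_def)
  ultimately show False
    using safe_at_not_adjacent[OF assms] reflexive by (auto simp: refl_on_def)
qed

text \<open>The projection of \<open>c\<close> contains some \<open>d\<close> in \<open>G n\<close>;
  any vertex of \<open>G n\<close> that \<open>d\<close> misses is safe.\<close>

lemma safe_at_placement:
  assumes "1 \<le> n" "n \<le> L" "c \<in> V"
    and "\<And>d. d \<in> G n \<Longrightarrow> \<exists>x\<in>G n. (d, x) \<notin> E"
  obtains x where "x \<in> V" "safe_at n c x"
proof -
  have n: "n - 1 < L" using assms by simp
  obtain d where d: "d \<in> project_upto V E (n - 1) {c}"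
    using project_upto_nonempty[OF n, of "{c}"] assms by auto
  moreover have "d \<in> G n"
    using d project_upto_stage[OF n, of "{c}"] assms by auto
  ultimately show thesis
    using assms that stage_subset by (force simp: safe_at_def)
qed

lemma not_dominated:
  assumes "1 \<le> n" "\<not> is_clique E (G (Suc n))" "d \<in> G n"
  shows "\<exists>x\<in>G n. (d, x) \<notin> E"
  using dominating_imp_clique[OF symmetric assms(3)] assms(1,2) by (auto simp: stage_Suc)

lemma safe_at_step:
  assumes "safe_at (Suc n) c x" "1 \<le> n" "(c, d) \<in> E"
  obtains y where "(x, y) \<in> E" "safe_at n d y"
proof -
  obtain j where j: "n = Suc j" using assms(2) by (cases n) auto
  have n: "1 \<le> n" "n < L" "j < L" using assms j by (auto simp: safe_at_def)
  have sub: "project_upto V E j {c} \<subseteq> G n" "project_upto V E j {d} \<subseteq> G n"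
    using project_upto_stage[of j] n assms(3) vertex_of_edge unfolding j by simp_all
  \<comment> \<open>Level \<open>Suc n\<close> uses one projection more than level \<open>n\<close>:
    \<open>c'\<close> arises under \<open>project V E n\<close> from a vertex \<open>u\<close> of
    the same projection of \<open>c\<close> that is applied to \<open>d\<close>. So \<open>u\<close>
    and \<open>d'\<close> are adjacent, and \<open>c'\<close> inherits the neighbour
    \<open>d'\<close>.\<close>
  obtain c' where c': "c' \<in> project V E n (project_upto V E j {c})" "(c', x) \<notin> E"
    using assms j by (auto simp: safe_at_def)
  obtain u where u: "u \<in> project_upto V E j {c}" "\<And>v. v \<in> G n \<Longrightarrow> (v, u) \<in> E \<Longrightarrow> (v, c') \<in> E"
    using project_adjacent[OF n(1,2) sub(1) c'(1)] by blast
  obtain d' where d': "d' \<in> project_upto V E j {d}"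
    using project_upto_nonempty[of j "{d}"] n assms(3) vertex_of_edge by auto
  have "(u, d') \<in> E" using project_upto_adjacent n assms(3) u d' by blast
  then have "(c', d') \<in> E" using u d' sub edge_sym by blast
  moreover have "c' \<in> G n"
    using c' in_project[OF n(1,2) sub(1)] stage_Suc_subset by blast
  moreover have "x \<in> G n - strict_corners E (G n)"
    using assms(1) n by (simp add: safe_at_def stage_Suc)
  ultimately obtain y where "y \<in> G n" "(x, y) \<in> E" "(d', y) \<notin> E"
    using escape_within[OF symmetric, of x "G n" d' c'] c' d' sub by blast
  then show thesis using that d' n j by (auto simp: safe_at_def)
qed

text \<open>Without strict corners in \<open>G L\<close>, the escape already works there, so
  \<open>c'\<close> and \<open>d'\<close> come from the same projection and no level is
  lost.\<close>

lemma safe_at_last_step: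
  assumes "safe_at L c x" "strict_corners E (G L) = {}" "(c, d) \<in> E"
  obtains y where "(x, y) \<in> E" "safe_at L d y"
proof -
  have L: "L - 1 < L" "Suc (L - 1) = L" using last_stage_ge_1 by auto
  have sub: "project_upto V E (L - 1) {c} \<subseteq> G L" "project_upto V E (L - 1) {d} \<subseteq> G L"
    using project_upto_stage[OF L(1)] L assms(3) vertex_of_edge by auto
  obtain c' where c': "c' \<in> project_upto V E (L - 1) {c}" "(c', x) \<notin> E"
    using assms by (auto simp: safe_at_def)
  obtain d' where d': "d' \<in> project_upto V E (L - 1) {d}"
    using project_upto_nonempty[OF L(1), of "{d}"] assms(3) vertex_of_edge by auto
  have "(c', d') \<in> E" using project_upto_adjacent L(1) assms(3) c' d' by blast
  then obtain y where "y \<in> G L" "(x, y) \<in> E" "(d', y) \<notin> E"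
    using escape_within[OF symmetric, of x "G L" d' c'] c' d' sub assms
    by (auto simp: safe_at_def)
  then show thesis using that d' last_stage_ge_1 by (auto simp: safe_at_def)
qed

section \<open>Higher Way moves\<close>

lemma higher_way_neq:
  assumes "higher_way_move V E c A x"
  shows "c \<noteq> x"
proof (cases "\<exists>y\<in>A. \<exists>j. proj_safe V E c j y")
  case True
  with assms obtain k where "proj_safe V E c k x"
    unfolding higher_way_move_def by (simp only: if_True) blast
  then show ?thesis by (rule proj_safe_imp_safe_at[THEN safe_at_neq])
next
  case False
  with assms show ?thesis unfolding higher_way_move_def by (simp only: if_False) blast
qed

lemma higher_way_safe_at:
  assumes "higher_way_move V E c A x" "y \<in> A" "safe_at n c y"
  obtains m where "n \<le> m" "safe_at m c x"
proof -
  have "proj_safe V E c (enat n) y" using safe_at_imp_proj_safe assms by blast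
  with assms obtain k where k: "proj_safe V E c k x" "enat n \<le> k"
    unfolding higher_way_move_def by (metis (full_types))
  \<comment> \<open>The best level may be \<infinity>, which is read as \<open>L\<close>.\<close>
  moreover have "n \<le> L" using assms by (simp add: safe_at_def)
  ultimately show thesis
    using that[OF _ proj_safe_imp_safe_at[OF k(1)]] by (cases k) auto
qed

lemma higher_way_safe_at_last:
  assumes "higher_way_move V E c A x" "y \<in> A" "safe_at L c y"
  shows "safe_at L c x"
  using higher_way_safe_at[OF assms] by (metis le_antisym safe_at_def)

end

section \<open>Plays against a Higher Way robber\<close>

locale higher_way_play = reflexive_graph +
  fixes \<sigma> :: "'a list \<Rightarrow> 'a" and c :: "nat \<Rightarrow> 'a"
  assumes strategy: "higher_way_strategy V E \<sigma>"
    and cop: "cop_moves V E c"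
begin

abbreviation "rob \<equiv> robber_path \<sigma> c"

text \<open>The premise under which \<open>higher_way_strategy\<close> governs the robber's turn
  \<open>n\<close>: it covers the \<open>n\<close>-th cop move but not the robber's reply.\<close>

definition alive :: "nat \<Rightarrow> bool" where
  "alive n \<longleftrightarrow> (\<forall>i<n. c i \<noteq> rob i \<and> c (Suc i) \<noteq> rob i)"

lemma robber_placement: "higher_way_move V E (c 0) V (rob 0)"
  using strategy[unfolded higher_way_strategy_def, rule_format, OF cop, of 0] by simp

lemma robber_move:
  "alive (Suc n) \<Longrightarrow> higher_way_move V E (c (Suc n)) {y. (rob n, y) \<in> E} (rob (Suc n))"
  using strategy[unfolded higher_way_strategy_def, rule_format, OF cop, of "Suc n"]
  by (simp add: alive_def)

lemma alive_neq: "alive n \<Longrightarrow> c n \<noteq> rob n"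
  using robber_placement robber_move higher_way_neq by (cases n) auto

lemma alive_not_caught: "alive n \<Longrightarrow> \<not> caught c rob n"
  using alive_neq by (cases n) (auto simp: caught_def alive_def)

lemma cop_edge: "(c n, c (Suc n)) \<in> E"
  using cop by (simp add: cop_moves_def)

lemma alive_Suc:
  assumes "alive n" "safe_at m (c n) (rob n)"
  shows "alive (Suc n)"
  using assms safe_at_not_adjacent[OF assms(2)] alive_neq cop_edge[of n]
  by (auto simp: alive_def less_Suc_eq)

text \<open>Invariant: at most one level is lost per cop move. Level 1 still survives the next cop
  move, hence survival alone is claimed at \<open>n = m\<close>; for \<open>m = 0\<close> the
  placement need not be safe.\<close>

lemma alive_if_safe_placement:
  assumes "m = 0 \<or> (\<exists>x\<in>V. safe_at m (c 0) x)" "n \<le> m"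
  shows "alive n \<and> (n < m \<longrightarrow> (\<exists>k\<ge>m - n. safe_at k (c n) (rob n)))"
  using assms(2)
proof (induction n)
  case 0
  have "\<exists>k\<ge>m. safe_at k (c 0) (rob 0)" if m: "0 < m"
  proof -
    obtain x where "x \<in> V" "safe_at m (c 0) x" using m assms(1) by auto
    then show ?thesis using higher_way_safe_at[OF robber_placement] by metis
  qed
  then show ?case by (simp add: alive_def)
next
  case (Suc n)
  then obtain k where k: "m - n \<le> k" "safe_at k (c n) (rob n)" "alive n" by auto
  then have al: "alive (Suc n)" using alive_Suc by blast
  moreover have "\<exists>k\<ge>m - Suc n. safe_at k (c (Suc n)) (rob (Suc n))" if n: "Suc n < m"
  proof -
    \<comment> \<open>Here \<open>k\<close> is at least 2, so a level \<open>j\<close> of at least 1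
      remains for \<open>safe_at_step\<close>.\<close>
    obtain j where j: "k = Suc j" "1 \<le> j" using n k(1) by (cases k) auto
    obtain y where "(rob n, y) \<in> E" "safe_at j (c (Suc n)) y"
      using safe_at_step[of j] k j cop_edge by metis
    then obtain k' where "j \<le> k'" "safe_at k' (c (Suc n)) (rob (Suc n))"
      using higher_way_safe_at[OF robber_move[OF al]] by blast
    moreover have "m - Suc n \<le> j" using k j by simp
    ultimately show ?thesis by (meson le_trans)
  qed
  ultimately show ?case by blast
qed

lemma game_length_gt:
  assumes "m = 0 \<or> (\<exists>x\<in>V. safe_at m (c 0) x)"
  shows "enat (Suc m) \<le> game_length c rob"
  unfolding game_length_def
proof (rule INF_greatest)
  fix n assume "n \<in> {n. caught c rob n}"
  then have "\<not> n \<le> m" using alive_if_safe_placement[OF assms] alive_not_caught by auto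
  then show "enat (Suc m) \<le> enat n" by simp
qed

lemma c_0_in_V: "c 0 \<in> V"
  using cop by (simp add: cop_moves_def)

lemma length_bound:
  assumes "cop_win V E r"
  shows "graph_cr V E - enat r \<le> game_length c rob"
proof -
  obtain \<alpha> where \<alpha>: "graph_cr V E = enat \<alpha>" "2 \<le> \<alpha>"
    and r: "r = (if \<exists>v\<in>V. cr V E v = enat \<alpha> \<and> (\<forall>w\<in>G (\<alpha> - 1). (v, w) \<in> E) then 1 else 0)"
    using assms by (auto simp: cop_win_def)
  have L: "L = \<alpha>" "is_clique E (G L)" using \<alpha>(1) by (auto simp: graph_cr_eq split: if_splits)
  have "r \<le> 1" using r by simp
  \<comment> \<open>A placement at level \<open>m\<close> forces \<open>m + 1\<close> cop moves,
    which is \<open>\<alpha> - r\<close>.\<close>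
  define m where "m = \<alpha> - r - 1"
  have "m = 0 \<or> (\<exists>x\<in>V. safe_at m (c 0) x)"
  proof (cases "m = 0")
    case False
    have "\<exists>x\<in>G m. (d, x) \<notin> E" if d: "d \<in> G m" for d
    \<comment> \<open>For \<open>r = 1\<close>, \<open>Suc m\<close> is \<alpha> - 1, before the
      last stage, so \<open>G (Suc m)\<close> is no clique. For \<open>r = 0\<close> the next stage
      is the final clique; instead, a vertex dominating \<open>G m\<close> would survive to rank
      \<alpha> and witness \<open>r = 1\<close>.\<close>
    proof (cases "r = 1")
      case True
      then have "\<not> is_clique E (G (Suc m))"
        using before_last_stage(1)[of "Suc m"] False L(1) unfolding m_def by simp
      then show ?thesis using not_dominated[of m d] d False by simp
    next
      case r0: False
      then have m: "Suc m = L" "m = \<alpha> - 1" "1 \<le> m"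
        using \<open>r \<le> 1\<close> \<alpha>(2) L(1) False unfolding m_def by auto
      show ?thesis
      proof (rule ccontr)
        assume "\<not> ?thesis"
        then have dom: "\<forall>x\<in>G m. (d, x) \<in> E" by blast
        have "d \<notin> strict_corners E (G m)"
          using dom edge_sym by (auto simp: strict_corners_def strictly_corners_def)
        then have "d \<in> G L" using stage_Suc[OF m(3)] m(1) d by simp
        then have "cr V E d = enat \<alpha>" "d \<in> V"
          using L stage_subset by (auto simp: cr_def)
        then have "\<exists>v\<in>V. cr V E v = enat \<alpha> \<and> (\<forall>w\<in>G (\<alpha> - 1). (v, w) \<in> E)"
          using dom m(2) by blast
        with r r0 show False by simp
      qed
    qed
    moreover have "1 \<le> m" "m \<le> L" using False L(1) by (auto simp: m_def)
    ultimately show ?thesis using safe_at_placement c_0_in_V by metis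
  qed simp
  then have "enat (Suc m) \<le> game_length c rob" by (rule game_length_gt)
  moreover have "graph_cr V E - enat r = enat (Suc m)"
    using \<alpha> \<open>r \<le> 1\<close> by (simp add: m_def)
  ultimately show ?thesis by simp
qed

lemma never_caught:
  assumes "graph_cr V E = \<infinity>"
  shows "\<not> caught c rob n"
proof -
  have nc: "\<not> is_clique E (G L)" using assms by (auto simp: graph_cr_eq)
  then have ns: "strict_corners E (G L) = {}" using last_stage_stops by blast
  \<comment> \<open>The sequence is stationary at \<open>L\<close>, so \<open>not_dominated\<close>
    applies at \<open>L\<close> itself.\<close>
  have "\<not> is_clique E (G (Suc L))" using nc ns last_stage_ge_1 by (simp add: stage_Suc)
  then obtain x where x: "x \<in> V" "safe_at L (c 0) x"
    using safe_at_placement[of L "c 0"] not_dominated[of L] c_0_in_V last_stage_ge_1 by blast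
  have "alive n \<and> safe_at L (c n) (rob n)"
  proof (induction n)
    case 0
    show ?case using higher_way_safe_at_last[OF robber_placement x] by (simp add: alive_def)
  next
    case (Suc n)
    then have al: "alive (Suc n)" using alive_Suc by blast
    obtain y where "(rob n, y) \<in> E" "safe_at L (c (Suc n)) y"
      using safe_at_last_step[OF _ ns cop_edge] Suc by blast
    then show ?case using al higher_way_safe_at_last[OF robber_move[OF al]] by blast
  qed
  then show ?thesis using alive_not_caught by blast
qed

end

theorem theorem5p5:
  fixes V :: "'a set" and E :: "('a \<times> 'a) set"
    and \<sigma> :: "'a list \<Rightarrow> 'a" and c :: "nat \<Rightarrow> 'a"
  assumes "reflexive_graph V E"
    and "higher_way_strategy V E \<sigma>"
    and "cop_moves V E c"
  shows "(\<forall>r\<in>{0, 1}. cop_win V E r \<longrightarrow>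
            graph_cr V E - enat r \<le> game_length c (robber_path \<sigma> c)) \<and>
         (graph_cr V E = \<infinity> \<longrightarrow> (\<forall>n. \<not> caught c (robber_path \<sigma> c) n))"
proof -
  interpret higher_way_play V E \<sigma> c
    using assms by (simp add: higher_way_play_def higher_way_play_axioms_def)
  show ?thesis using length_bound never_caught by blast
qed

end
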